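(* Let $N$ be a finite ground set with $n=|N|$, let $f_1,f_2:2^N\to\mathbb{R}$ be monotone submodular functions with $f_i(\emptyset)=0$, let $k$ be a positive integer, $m\geq 2$ an integer, and $V_1,V_2\geq 0$ reals. Consider the following algorithm (Generalized Greedy Algorithm, input $m,V_1,V_2$): initialize $A=\emptyset$; while $|A|<k$: set $m=\min\{m,k-|A|\}$, find by enumeration a set $X\subseteq N\setminus A$ with $|X|=m$ such that $f_i(X\mid A)\geq \frac{m-1}{k}\,[V_i-f_i(A)]$ for $i=1,2$, and set $A=A\cup X$; output $A$. If there exists a set $S\subseteq N$ with $|S|=k$ and $f_i(S)\geq V_i$ for $i=1,2$, then the algorithm finds a set $A$ with $|A|=l$ (in particular the output, with $l=k$) such that $$f_i(A)\geq \Big(\beta\Big(0,\tfrac{l}{k}\Big)-\delta_m\Big)V_i\quad\text{for } i=1,2,$$ where $\delta_m=O(1/m)$ (i.e. $\delta_m\leq C/m$ for an absolute constant $C$), and it makes $O(n^{m+1})$ value queries.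
   Context: For $A,X\subseteq N$, $f_i(X\mid A)=f_i(A\cup X)-f_i(A)$. For $\eta\in[0,1]$ and $\alpha\geq 0$, $\beta(\eta,\alpha)=\frac{e^\alpha-1}{e^\alpha-\eta}$; note $\beta(0,\alpha)=1-e^{-\alpha}$.
   Formalization: The approximation bound is claimed only when m ≤ k or k ≥ 3; for k = 1, and for k = 2 with m > 2, it fails with an absolute C (e.g. k = 1: the test is f_i(X) ≥ 0, so a worthless element may be chosen). Success, |A| = k and the query bound are still proved there. *)

theory Defs
  imports Complex_Main "HOL-Library.While_Combinator"
begin

definition submodular_on :: "'a set \<Rightarrow> ('a set \<Rightarrow> real) \<Rightarrow> bool" where
  "submodular_on N g \<longleftrightarrow> (\<forall>A\<subseteq>N. \<forall>B\<subseteq>N. g (A \<union> B) + g (A \<inter> B) \<le> g A + g B)"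

definition marginal :: "('a set \<Rightarrow> real) \<Rightarrow> 'a set \<Rightarrow> 'a set \<Rightarrow> real" where
  "marginal g X A = g (A \<union> X) - g A"

definition \<beta> :: "real \<Rightarrow> real \<Rightarrow> real" where
  "\<beta> \<eta> \<alpha> = (exp \<alpha> - 1) / (exp \<alpha> - \<eta>)"

text \<open>Computations return their result together with the number of value queries made. Below, the
  algorithm accesses the set functions only through \<open>query\<close>, and no value is stored for reuse.\<close>

definition query :: "('a set \<Rightarrow> real) \<Rightarrow> 'a set \<Rightarrow> real \<times> nat" where
  "query g A = (g A, 1)"

definition query_marginal :: "('a set \<Rightarrow> real) \<Rightarrow> 'a set \<Rightarrow> 'a set \<Rightarrow> real \<times> nat" where
  "query_marginal g X A =
    (let (b, q) = query g (A \<union> X); (a, r) = query g A in (b - a, q + r))"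

lemma query_marginal_eq: "query_marginal g X A = (marginal g X A, 2)"
  by (simp add: query_marginal_def query_def marginal_def)

definition gga_test ::
  "('a set \<Rightarrow> real) \<Rightarrow> real \<Rightarrow> nat \<Rightarrow> nat \<Rightarrow> 'a set \<Rightarrow> 'a set \<Rightarrow> bool \<times> nat" where
  "gga_test g v k m A X =
    (let (d, q) = query_marginal g X A; (a, r) = query g A
     in (d \<ge> (real m - 1) / real k * (v - a), q + r))"

lemma gga_test_eq:
  "gga_test g v k m A X = (marginal g X A \<ge> (real m - 1) / real k * (v - g A), 3)"
  by (simp add: gga_test_def query_marginal_eq query_def)

text \<open>The candidates are tested in the given order until the first one that passes for \<open>i = 1, 2\<close>.\<close>

fun gga_find ::
  "(nat \<Rightarrow> 'a set \<Rightarrow> real) \<Rightarrow> (nat \<Rightarrow> real) \<Rightarrow> nat \<Rightarrow> nat \<Rightarrow> 'a set \<Rightarrow> 'a set list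
    \<Rightarrow> 'a set option \<times> nat" where
  "gga_find f V k m A [] = (None, 0)"
| "gga_find f V k m A (X # Xs) =
    (let (b\<^sub>1, q\<^sub>1) = gga_test (f 1) (V 1) k m A X;
         (b\<^sub>2, q\<^sub>2) = gga_test (f 2) (V 2) k m A X
     in if b\<^sub>1 \<and> b\<^sub>2 then (Some X, q\<^sub>1 + q\<^sub>2)
        else (let (r, q) = gga_find f V k m A Xs in (r, q\<^sub>1 + q\<^sub>2 + q)))"

text \<open>An enumeration order for the fixed-size subsets of each \<open>B \<subseteq> N\<close>. The sets \<open>N - A\<close> searched in the
  course of one run are pairwise different, so quantifying over all such orders amounts to letting
  each search return an arbitrary admissible set.\<close>

definition enumerates :: "'a set \<Rightarrow> ('a set \<Rightarrow> nat \<Rightarrow> 'a set list) \<Rightarrow> bool" where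
  "enumerates N enum \<longleftrightarrow>
    (\<forall>B\<subseteq>N. \<forall>j. distinct (enum B j) \<and> set (enum B j) = {X. X \<subseteq> B \<and> card X = j})"

lemma enumerates_exists:
  assumes "finite N"
  shows "\<exists>enum. enumerates N enum"
proof -
  have "\<exists>xs. B \<subseteq> N \<longrightarrow> distinct xs \<and> set xs = {X. X \<subseteq> B \<and> card X = j}" for B j
  proof (cases "B \<subseteq> N")
    case True
    then have "finite {X. X \<subseteq> B \<and> card X = j}"
      using assms by (auto intro: finite_subset[of _ "Pow N"])
    then show ?thesis using finite_distinct_list by metis
  qed simp
  then show ?thesis unfolding enumerates_def by metis
qed

text \<open>\<open>visited\<close> records all values taken by the variable \<open>A\<close> (the field \<open>cur\<close>); \<open>failed\<close> is set
  when a search finds no admissible set.\<close>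

record 'a gga_state =
  block :: nat
  cur :: "'a set"
  visited :: "'a set list"
  queries :: nat
  failed :: bool

definition gga_init :: "nat \<Rightarrow> 'a gga_state" where
  "gga_init m = \<lparr>block = m, cur = {}, visited = [{}], queries = 0, failed = False\<rparr>"

definition gga_step ::
  "'a set \<Rightarrow> (nat \<Rightarrow> 'a set \<Rightarrow> real) \<Rightarrow> (nat \<Rightarrow> real) \<Rightarrow> nat \<Rightarrow> ('a set \<Rightarrow> nat \<Rightarrow> 'a set list)
    \<Rightarrow> 'a gga_state \<Rightarrow> 'a gga_state" where
  "gga_step N f V k enum s =
    (let A = cur s;
         m = min (block s) (k - card A);
         (r, q) = gga_find f V k m A (enum (N - A) m)
     in case r of
          None \<Rightarrow> s\<lparr>block := m, queries := queries s + q, failed := True\<rparr>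
        | Some X \<Rightarrow> s\<lparr>block := m, cur := A \<union> X, visited := visited s @ [A \<union> X],
                     queries := queries s + q\<rparr>)"

definition gga ::
  "'a set \<Rightarrow> (nat \<Rightarrow> 'a set \<Rightarrow> real) \<Rightarrow> (nat \<Rightarrow> real) \<Rightarrow> nat \<Rightarrow> ('a set \<Rightarrow> nat \<Rightarrow> 'a set list)
    \<Rightarrow> nat \<Rightarrow> 'a gga_state option" where
  "gga N f V k enum m =
    while_option (\<lambda>s. card (cur s) < k \<and> \<not> failed s) (gga_step N f V k enum) (gga_init m)"

end

theory Submission
  imports Defs
begin

text \<open>Let \<open>T = S - A\<close>. The marginals of \<open>f\<^sub>i(\<cdot> | A)\<close> along an ordering of \<open>T\<close> give nonnegative weights
  \<open>w\<^sub>i\<close> with \<open>w\<^sub>i(T) = f\<^sub>i(T | A)\<close> and \<open>w\<^sub>i(X) \<le> f\<^sub>i(X | A)\<close> for \<open>X \<subseteq> T\<close>. The uniform fractional point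
  of total mass \<open>m - 1\<close> on \<open>T\<close> can be moved, keeping its mass and without decreasing either weight,
  to a point with at most two fractional coordinates; its support has at most \<open>m\<close> elements, so an
  admissible set always exists. Every step then contracts \<open>V\<^sub>i - f\<^sub>i(A)\<close> by the factor
  \<open>1 - (m - 1) / k \<le> exp (- (m - 1) / k)\<close>, hence after \<open>j\<close> steps the residual is at most
  \<open>exp (- (l - j) / k) V\<^sub>i\<close> with \<open>j / k \<le> 2 / m\<close>. Each step makes at most \<open>6 n\<^sup>m\<close> queries and adds an
  element.\<close>

section \<open>Additive minorants of monotone submodular functions\<close>

text \<open>Each new element is weighted by its marginal over everything inserted before it. By
  diminishing returns this is at most its marginal over any smaller set, so no subset is
  overestimated. The weights are a greedy vertex of the base polytope of \<open>g\<close>.\<close>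

lemma additive_minorant:
  fixes g :: "'a set \<Rightarrow> real"
  assumes "finite T"
    and "\<And>A B. A \<subseteq> B \<Longrightarrow> B \<subseteq> T \<Longrightarrow> g A \<le> g B"
    and "\<And>A B. A \<subseteq> T \<Longrightarrow> B \<subseteq> T \<Longrightarrow> g (A \<union> B) + g (A \<inter> B) \<le> g A + g B"
    and "g {} = 0"
  shows "\<exists>w. (\<forall>x\<in>T. 0 \<le> w x) \<and> sum w T = g T \<and> (\<forall>X\<subseteq>T. sum w X \<le> g X)"
  using assms
proof (induction T rule: finite_induct)
  case empty
  then show ?case by auto
next
  case (insert x T)
  have "\<exists>w. (\<forall>x\<in>T. 0 \<le> w x) \<and> sum w T = g T \<and> (\<forall>X\<subseteq>T. sum w X \<le> g X)"
  proof (rule insert.IH)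
    show "g A \<le> g B" if "A \<subseteq> B" "B \<subseteq> T" for A B
      using insert.prems(1)[OF that(1)] that(2) by blast
    show "g (A \<union> B) + g (A \<inter> B) \<le> g A + g B" if "A \<subseteq> T" "B \<subseteq> T" for A B
      using insert.prems(2)[of A B] that by blast
  qed (fact insert.prems(3))
  then obtain w where w: "\<forall>x\<in>T. 0 \<le> w x" "sum w T = g T" "\<forall>X\<subseteq>T. sum w X \<le> g X"
    by blast
  define w' where "w' = w(x := g (insert x T) - g T)"
  have eq: "sum w' X = sum w X" if "X \<subseteq> T" for X
    using that insert.hyps by (intro sum.cong) (auto simp: w'_def)
  have "g T \<le> g (insert x T)" by (rule insert.prems(1)) auto
  then have "\<forall>y\<in>insert x T. 0 \<le> w' y" using w(1) by (auto simp: w'_def)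
  moreover have "sum w' (insert x T) = g (insert x T)"
    using insert.hyps eq[of T] w(2) by (simp add: w'_def)
  moreover have "sum w' X \<le> g X" if X: "X \<subseteq> insert x T" for X
  proof (cases "x \<in> X")
    case False
    then have "X \<subseteq> T" using X by auto
    then show ?thesis using eq w(3) by simp
  next
    case True
    define Y where "Y = X - {x}"
    have Y: "Y \<subseteq> T" "X = insert x Y" "x \<notin> Y" "finite Y"
      using X True insert.hyps finite_subset[of Y T] by (auto simp: Y_def)
    have sets: "X \<union> T = insert x T" "X \<inter> T = Y" using X True Y insert.hyps by auto
    \<comment> \<open>Submodularity for \<open>X\<close> and \<open>T\<close> says that the marginal
      of \<open>x\<close> over \<open>T\<close> is at most the one over \<open>Y\<close>.\<close>
    have "g (X \<union> T) + g (X \<inter> T) \<le> g X + g T"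
      using X by (intro insert.prems(2)) auto
    then have "g Y + (g (insert x T) - g T) \<le> g X" unfolding sets by linarith
    moreover have "sum w' X = (g (insert x T) - g T) + sum w Y"
      using Y eq[of Y] by (simp add: w'_def)
    moreover have "sum w Y \<le> g Y" using w(3) Y(1) by blast
    ultimately show ?thesis by linarith
  qed
  ultimately show ?case by blast
qed

section \<open>Rounding a fractional point under two linear objectives\<close>

text \<open>This is a ratio test: every moving coordinate reaches an end of the unit interval after
  its own step length, and the smallest of these lengths is a feasible \<open>t\<close>.\<close>

lemma move_to_boundary:
  fixes y d :: "'a \<Rightarrow> real"
  assumes "finite F" and y: "\<forall>a\<in>F. 0 < y a \<and> y a < 1" and "b \<in> F" "d b \<noteq> 0"
  obtains t where "0 \<le> t" "\<forall>a\<in>F. 0 \<le> y a + t * d a \<and> y a + t * d a \<le> 1"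
    "\<exists>a\<in>F. y a + t * d a \<in> {0, 1}"
proof -
  define h where "h a = (if d a > 0 then (1 - y a) / d a else y a / (- d a))" for a
  \<comment> \<open>Coordinates with \<open>d a = 0\<close> must be left out: division by zero would
    give them \<open>h a = 0\<close>, which would win the minimum without any coordinate having
    reached an end.\<close>
  define G where "G = {a\<in>F. d a \<noteq> 0}"
  have "finite G" "G \<noteq> {}" using assms by (auto simp: G_def)
  then obtain a where a: "a \<in> G" "\<forall>c\<in>G. h a \<le> h c"
    by (metis arg_min_if_finite(1) arg_min_least)
  have pos: "0 \<le> h a"
    using a(1) y by (auto simp: h_def G_def divide_simps not_less dest!: bspec)
  have "0 \<le> y c + h a * d c \<and> y c + h a * d c \<le> 1" if c: "c \<in> F" for c
  proof -
    consider "d c = 0" | "d c > 0" | "d c < 0" by linarith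
    then show ?thesis
    proof cases
      case 1
      then show ?thesis using y c by (simp add: less_imp_le)
    next
      case 2
      then have "h a \<le> (1 - y c) / d c" using a(2) c by (auto simp: h_def[of c] G_def)
      then have "h a * d c \<le> 1 - y c" using 2 by (simp add: pos_le_divide_eq)
      moreover have "0 \<le> h a * d c" using pos 2 by simp
      ultimately show ?thesis using y c by (smt (verit))
    next
      case 3
      then have "h a \<le> y c / (- d c)" using a(2) c by (auto simp: h_def[of c] G_def)
      then have "h a * (- d c) \<le> y c" using 3 by (subst (asm) pos_le_divide_eq) auto
      moreover have "h a * d c \<le> 0" using pos 3 by (simp add: mult_nonneg_nonpos)
      ultimately show ?thesis using y c by (smt (verit) mult_minus_right)
    qed
  qed
  moreover have "y a + h a * d a \<in> {0, 1}" using a(1) by (auto simp: h_def G_def)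
  moreover have "a \<in> F" using a(1) by (simp add: G_def)
  ultimately show ?thesis using that[of "h a"] pos by blast
qed

text \<open>Three fractional coordinates admit a direction that keeps the mass and the
  \<open>u\<close>-value. Oriented so that the \<open>v\<close>-value does not fall and followed
  until a coordinate becomes integral, it lowers the number of fractional coordinates.\<close>

lemma round_to_two_fractional:
  fixes u v y :: "'a \<Rightarrow> real"
  assumes "finite T" and "\<forall>a\<in>T. 0 \<le> y a \<and> y a \<le> 1"
  shows "\<exists>z. (\<forall>a\<in>T. 0 \<le> z a \<and> z a \<le> 1) \<and> sum z T = sum y T \<and>
    (\<Sum>a\<in>T. u a * y a) \<le> (\<Sum>a\<in>T. u a * z a) \<and> (\<Sum>a\<in>T. v a * y a) \<le> (\<Sum>a\<in>T. v a * z a) \<and>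
    card {a\<in>T. 0 < z a \<and> z a < 1} \<le> 2"
  using assms(2)
proof (induction "card {a\<in>T. 0 < y a \<and> y a < 1}" arbitrary: y rule: less_induct)
  case less
  define F where "F = {a\<in>T. 0 < y a \<and> y a < 1}"
  have finF: "finite F" using assms(1) by (simp add: F_def)
  show ?case
  proof (cases "card F \<le> 2")
    case True
    then show ?thesis using less.prems unfolding F_def by blast
  next
    case False
    then have "3 \<le> card F" by simp
    then obtain P where P: "P \<subseteq> F" "card P = 3" by (meson obtain_subset_with_card_n)
    then obtain a b c where abc: "P = {a, b, c}" "a \<noteq> b" "a \<noteq> c" "b \<noteq> c"
      by (auto simp: card_3_iff)
    \<comment> \<open>Two linear equations in three unknowns have a nonzero solution.\<close>
    have "\<exists>p q r :: real. (p \<noteq> 0 \<or> q \<noteq> 0 \<or> r \<noteq> 0) \<and> p + q + r = 0 \<and> u a * p + u b * q + u c * r = 0"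
    proof (cases "u a = u b \<and> u b = u c")
      case True
      then show ?thesis by (intro exI[of _ 1] exI[of _ "-1"] exI[of _ 0]) simp
    next
      case False
      then show ?thesis
        \<comment> \<open>Up to sign, this is the cross product of \<open>(1, 1, 1)\<close> and
          \<open>(u a, u b, u c)\<close>, which is nonzero since the three values are not all
          equal.\<close>
        by (intro exI[of _ "u b - u c"] exI[of _ "u c - u a"] exI[of _ "u a - u b"])
          (auto simp: algebra_simps)
    qed
    then obtain p0 q0 r0 :: real where 0: "p0 \<noteq> 0 \<or> q0 \<noteq> 0 \<or> r0 \<noteq> 0" "p0 + q0 + r0 = 0"
      "u a * p0 + u b * q0 + u c * r0 = 0" by blast
    define \<sigma> :: real where "\<sigma> = (if v a * p0 + v b * q0 + v c * r0 \<ge> 0 then 1 else -1)"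
    define d where "d x = \<sigma> * (if x = a then p0 else if x = b then q0 else if x = c then r0 else 0)"
      for x
    have sum_d: "(\<Sum>x\<in>T. w x * d x) = \<sigma> * (w a * p0 + w b * q0 + w c * r0)" for w
    proof -
      have "(\<Sum>x\<in>T. w x * d x) = (\<Sum>x\<in>{a, b, c}. w x * d x)"
        using assms(1) P abc by (intro sum.mono_neutral_right) (auto simp: d_def F_def)
      then show ?thesis using abc by (simp add: d_def algebra_simps)
    qed
    have "\<exists>x\<in>F. d x \<noteq> 0"
      using 0(1) P abc by (auto simp: d_def \<sigma>_def)
    then obtain x0 where x0: "x0 \<in> F" "d x0 \<noteq> 0" by blast
    have "\<forall>x\<in>F. 0 < y x \<and> y x < 1" by (simp add: F_def)
    then obtain t where t: "0 \<le> t" "\<forall>x\<in>F. 0 \<le> y x + t * d x \<and> y x + t * d x \<le> 1"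
      "\<exists>x\<in>F. y x + t * d x \<in> {0, 1}"
      using move_to_boundary[of F y x0 d] finF x0 by blast
    define z where "z x = y x + t * d x" for x
    have d0: "d x = 0" if "x \<notin> F" for x using that P abc by (auto simp: d_def)
    have sum_z: "(\<Sum>x\<in>T. w x * z x) = (\<Sum>x\<in>T. w x * y x) + t * (\<sigma> * (w a * p0 + w b * q0 + w c * r0))"
      for w
      unfolding sum_d[symmetric] z_def by (simp add: sum.distrib sum_distrib_left algebra_simps)
    have z01: "\<forall>x\<in>T. 0 \<le> z x \<and> z x \<le> 1"
      using t(2) d0 less.prems unfolding z_def by (metis add.right_neutral mult_zero_right)
    have "{x\<in>T. 0 < z x \<and> z x < 1} \<subset> F"
    proof -
      have "{x\<in>T. 0 < z x \<and> z x < 1} \<subseteq> F"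
      proof
        fix x assume "x \<in> {x\<in>T. 0 < z x \<and> z x < 1}"
        then show "x \<in> F" using d0[of x] by (cases "x \<in> F") (auto simp: z_def F_def)
      qed
      moreover obtain x where "x \<in> F" "z x = 0 \<or> z x = 1" using t(3) unfolding z_def by blast
      ultimately show ?thesis by force
    qed
    then have "card {x\<in>T. 0 < z x \<and> z x < 1} < card {x\<in>T. 0 < y x \<and> y x < 1}"
      using finF psubset_card_mono unfolding F_def by blast
    from less.hyps[OF this z01] obtain z' where z': "\<forall>a\<in>T. 0 \<le> z' a \<and> z' a \<le> 1"
      "sum z' T = sum z T" "(\<Sum>a\<in>T. u a * z a) \<le> (\<Sum>a\<in>T. u a * z' a)"
      "(\<Sum>a\<in>T. v a * z a) \<le> (\<Sum>a\<in>T. v a * z' a)" "card {a\<in>T. 0 < z' a \<and> z' a < 1} \<le> 2"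
      by blast
    have "sum z T = sum y T" using sum_z[of "\<lambda>_. 1"] 0(2) by simp
    moreover have "(\<Sum>x\<in>T. u x * z x) = (\<Sum>x\<in>T. u x * y x)" using sum_z[of u] 0(3) by simp
    moreover have "0 \<le> \<sigma> * (v a * p0 + v b * q0 + v c * r0)" by (simp add: \<sigma>_def)
    then have "(\<Sum>x\<in>T. v x * y x) \<le> (\<Sum>x\<in>T. v x * z x)" using sum_z[of v] t(1) by simp
    ultimately show ?thesis using z' by (intro exI[of _ z']) auto
  qed
qed

text \<open>Round the uniform point of mass \<open>m - 1\<close> and take its support. Raising its
  coordinates to 1 and padding it to size \<open>m\<close> lose nothing because the weights are
  nonnegative. The missing unit of mass pays for the rounding.\<close>

lemma two_weights_subset:
  fixes u v :: "'a \<Rightarrow> real"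
  assumes fin: "finite T" and nonneg: "\<forall>x\<in>T. 0 \<le> u x" "\<forall>x\<in>T. 0 \<le> v x"
    and m: "1 \<le> m" "m \<le> card T"
  shows "\<exists>X\<subseteq>T. card X = m \<and> (real m - 1) / real (card T) * sum u T \<le> sum u X \<and>
    (real m - 1) / real (card T) * sum v T \<le> sum v X"
proof -
  define \<rho> where "\<rho> = (real m - 1) / real (card T)"
  have T0: "0 < card T" using m by linarith
  have \<rho>: "0 \<le> \<rho>" "\<rho> \<le> 1" "\<rho> * real (card T) = real m - 1"
    using m T0 by (auto simp: \<rho>_def divide_simps)
  obtain z where z: "\<forall>a\<in>T. 0 \<le> z a \<and> z a \<le> 1" "sum z T = (\<Sum>a\<in>T. \<rho>)"
    "(\<Sum>a\<in>T. u a * \<rho>) \<le> (\<Sum>a\<in>T. u a * z a)" "(\<Sum>a\<in>T. v a * \<rho>) \<le> (\<Sum>a\<in>T. v a * z a)"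
    "card {a\<in>T. 0 < z a \<and> z a < 1} \<le> 2"
    using round_to_two_fractional[OF fin, of "\<lambda>_. \<rho>" u v] \<rho> by auto
  define F where "F = {a\<in>T. 0 < z a \<and> z a < 1}"
  define P where "P = {a\<in>T. 0 < z a}"
  have fins: "finite F" "finite P" "F \<subseteq> P" using fin by (auto simp: F_def P_def)
  have sumP: "sum z T = sum z P"
    using fin z(1) by (intro sum.mono_neutral_right) (force simp: P_def)+
  also have "\<dots> = sum z (P - F) + sum z F" using fins by (simp add: sum.subset_diff)
  also have "sum z (P - F) = (\<Sum>a\<in>P - F. 1)"
    using z(1) by (intro sum.cong) (force simp: P_def F_def)+
  also have "\<dots> = real (card P) - real (card F)"
    using fins by (simp add: card_Diff_subset card_mono)
  finally have cP: "real (card P) = real m - 1 + real (card F) - sum z F"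
    using z(2) \<rho>(3) by (simp add: mult.commute)
  \<comment> \<open>At most two coordinates are fractional, and if there are any, their total is
    positive. So the support exceeds the mass \<open>m - 1\<close> by less than 2, and integrality
    does the rest.\<close>
  have "card P \<le> m"
  proof (cases "F = {}")
    case True
    then show ?thesis using cP by simp
  next
    case False
    then have "0 < sum z F" using fins by (intro sum_pos) (auto simp: F_def)
    moreover have "card F \<le> 2" using z(5) by (simp add: F_def)
    ultimately have "real (card P) < real m + 1" using cP by linarith
    then show ?thesis by linarith
  qed
  then obtain X where X: "P \<subseteq> X" "X \<subseteq> T" "card X = m"
    using exists_subset_between[of P m T] m(2) fin by (auto simp: P_def)
  have "\<rho> * sum w T \<le> sum w X"
    if w: "\<forall>x\<in>T. 0 \<le> w x" "(\<Sum>a\<in>T. w a * \<rho>) \<le> (\<Sum>a\<in>T. w a * z a)" for w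
  proof -
    have "\<rho> * sum w T \<le> (\<Sum>a\<in>T. w a * z a)" using w(2) by (simp add: sum_distrib_left mult.commute)
    also have "\<dots> = (\<Sum>a\<in>X. w a * z a)"
      using fin z(1) X by (intro sum.mono_neutral_right) (force simp: P_def)+
    also have "\<dots> \<le> sum w X" using w(1) z(1) X(2) by (intro sum_mono) (auto intro!: mult_left_le)
    finally show ?thesis .
  qed
  then show ?thesis using X nonneg z(3,4) unfolding \<rho>_def by blast
qed

section \<open>Existence of an admissible set\<close>

lemma marginal_additive_minorant:
  assumes "finite N" "mono_on (Pow N) g" "submodular_on N g" "A \<subseteq> N" "T \<subseteq> N"
  shows "\<exists>w. (\<forall>x\<in>T. 0 \<le> w x) \<and> sum w T = marginal g T A \<and> (\<forall>X\<subseteq>T. sum w X \<le> marginal g X A)"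
proof (rule additive_minorant)
  show "finite T" using assms finite_subset by blast
  show "marginal g X A \<le> marginal g Y A" if "X \<subseteq> Y" "Y \<subseteq> T" for X Y
  proof -
    have "g (A \<union> X) \<le> g (A \<union> Y)"
      using that assms by (intro mono_onD[OF assms(2)]) auto
    then show ?thesis by (simp add: marginal_def)
  qed
  show "marginal g (X \<union> Y) A + marginal g (X \<inter> Y) A \<le> marginal g X A + marginal g Y A"
    if "X \<subseteq> T" "Y \<subseteq> T" for X Y
  proof -
    have "A \<union> X \<subseteq> N" "A \<union> Y \<subseteq> N" using that assms by auto
    then have "g ((A \<union> X) \<union> (A \<union> Y)) + g ((A \<union> X) \<inter> (A \<union> Y)) \<le> g (A \<union> X) + g (A \<union> Y)"
      using assms(3) unfolding submodular_on_def by blast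
    moreover have "(A \<union> X) \<union> (A \<union> Y) = A \<union> (X \<union> Y)" "(A \<union> X) \<inter> (A \<union> Y) = A \<union> (X \<inter> Y)" by auto
    ultimately show ?thesis by (simp add: marginal_def)
  qed
  show "marginal g {} A = 0" by (simp add: marginal_def)
qed

text \<open>The part of \<open>S\<close> outside \<open>A\<close> has between
  \<open>k - card A\<close> and \<open>k\<close> elements, and by monotonicity adding it closes the
  whole gap \<open>V i - f i A\<close>. Minorants for both functions reduce the claim to two
  additive weights on it.\<close>

lemma admissible_set_exists:
  fixes f :: "nat \<Rightarrow> 'a set \<Rightarrow> real"
  assumes fin: "finite N"
    and f: "\<forall>i\<in>{1,2}. mono_on (Pow N) (f i) \<and> submodular_on N (f i)"
    and S: "S \<subseteq> N" "card S = k" "\<forall>i\<in>{1,2}. f i S \<ge> V i"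
    and A: "A \<subseteq> N" and m: "1 \<le> m" "m \<le> k - card A"
  shows "\<exists>X\<subseteq>N - A. card X = m \<and>
    (\<forall>i\<in>{1,2}. marginal (f i) X A \<ge> (real m - 1) / real k * (V i - f i A))"
proof -
  define T where "T = S - A"
  have finS: "finite S" "finite A" using S A fin finite_subset by blast+
  then have T: "finite T" "T \<subseteq> N" "k - card A \<le> card T" "card T \<le> k"
    using S diff_card_le_card_Diff[of A S] card_mono[of S T] by (auto simp: T_def)
  then have mT: "m \<le> card T" using m by linarith
  have "\<exists>w. (\<forall>x\<in>T. 0 \<le> w x) \<and> sum w T = marginal (f i) T A \<and> (\<forall>X\<subseteq>T. sum w X \<le> marginal (f i) X A)"
    if "i \<in> {1,2}" for i
    using marginal_additive_minorant[OF fin _ _ A T(2)] f that by blast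
  then obtain w where w: "\<And>i. i \<in> {1,2} \<Longrightarrow> (\<forall>x\<in>T. 0 \<le> w i x) \<and> sum (w i) T = marginal (f i) T A \<and>
      (\<forall>X\<subseteq>T. sum (w i) X \<le> marginal (f i) X A)" by metis
  obtain X where X: "X \<subseteq> T" "card X = m"
    "\<forall>i\<in>{1,2}. (real m - 1) / real (card T) * sum (w i) T \<le> sum (w i) X"
    using two_weights_subset[OF T(1), of "w 1" "w 2" m] w m mT by auto
  have "marginal (f i) X A \<ge> (real m - 1) / real k * (V i - f i A)" if i: "i \<in> {1,2}" for i
  proof -
    have T_le: "V i - f i A \<le> sum (w i) T"
    proof -
      have "f i S \<le> f i (A \<union> T)"
        using f i S A T by (intro mono_onD[of "Pow N" "f i"]) (auto simp: T_def)
      then show ?thesis using w[OF i] S(3) i by (auto simp: marginal_def)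
    qed
    \<comment> \<open>The denominator is changed only after passing to the nonnegative
      \<open>sum (w i) T\<close>, since \<open>V i - f i A\<close> may be negative.\<close>
    have "(real m - 1) / real k * (V i - f i A) \<le> (real m - 1) / real k * sum (w i) T"
      using T_le m by (intro mult_left_mono) auto
    also have "\<dots> \<le> (real m - 1) / real (card T) * sum (w i) T"
      using m mT T w[OF i] by (intro mult_right_mono frac_le sum_nonneg) auto
    also have "\<dots> \<le> marginal (f i) X A" using w[OF i] X i by (meson order_trans)
    finally show ?thesis .
  qed
  moreover have "X \<subseteq> N - A" using X(1) S(1) by (auto simp: T_def)
  ultimately show ?thesis using X(2) by blast
qed

section \<open>Outcome and cost of one search\<close>

text \<open>A test costs three queries, two for the marginal and one for \<open>g A\<close>, and is
  run for both functions.\<close>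

lemma gga_find_queries: "snd (gga_find f V k m A Xs) \<le> 6 * length Xs"
  by (induction Xs) (auto simp: gga_test_eq split: prod.splits)

lemma gga_find_Some:
  assumes "X \<in> set Xs"
    and "\<forall>i\<in>{1,2}. marginal (f i) X A \<ge> (real m - 1) / real k * (V i - f i A)"
  shows "\<exists>Y\<in>set Xs. fst (gga_find f V k m A Xs) = Some Y \<and>
    (\<forall>i\<in>{1,2}. marginal (f i) Y A \<ge> (real m - 1) / real k * (V i - f i A))"
  using assms by (induction Xs) (auto simp: gga_test_eq split: prod.splits)

lemma length_enum_le:
  assumes "enumerates N enum" "finite N" "A \<subseteq> N" "j \<le> card (N - A)" "j \<le> m" "0 < card N"
  shows "length (enum (N - A) j) \<le> card N ^ m"
proof -
  have e: "distinct (enum (N - A) j)" "set (enum (N - A) j) = {X. X \<subseteq> N - A \<and> card X = j}"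
    using assms(1) unfolding enumerates_def by (meson Diff_subset)+
  have "length (enum (N - A) j) = card {X. X \<subseteq> N - A \<and> card X = j}"
    using e distinct_card by metis
  also have "\<dots> = card (N - A) choose j" using assms(2) by (simp add: n_subsets)
  also have "\<dots> \<le> card (N - A) ^ j" using assms(4) by (rule binomial_le_pow)
  also have "\<dots> \<le> card N ^ j" using assms(2) by (intro power_mono card_mono) auto
  also have "\<dots> \<le> card N ^ m" using assms(5,6) by (intro power_increasing) auto
  finally show ?thesis .
qed

section \<open>Exponential estimates\<close>

text \<open>The function \<open>exp (- x)\<close> is 1-Lipschitz for \<open>x \<ge> 0\<close>. This
  turns a deficit in the exponent into an additive error.\<close>

lemma exp_minus_shift_le:
  fixes a b :: real
  assumes "0 \<le> a" "0 \<le> b"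
  shows "exp (- a) \<le> exp (- (a + b)) + b"
proof -
  have "exp (- a) * (1 - exp (- b)) \<le> 1 * b"
    using assms exp_ge_add_one_self[of "- b"] by (intro mult_mono) auto
  then show ?thesis by (simp add: algebra_simps exp_add[symmetric])
qed

text \<open>Gaining the fraction \<open>c\<close> of the residual scales it by
  \<open>1 - c \<le> exp (- c)\<close>. The hypothesis \<open>c \<le> 1\<close> keeps the factor
  nonnegative, so the residual itself may have any sign.\<close>

lemma residual_step:
  fixes v a b c t :: real
  assumes "0 \<le> v" "v - a \<le> exp (- t) * v" "c * (v - a) \<le> b - a" "c \<le> 1"
  shows "v - b \<le> exp (- (t + c)) * v"
proof -
  have "v - b \<le> (1 - c) * (v - a)" using assms(3) by (simp add: algebra_simps)
  also have "\<dots> \<le> (1 - c) * (exp (- t) * v)" using assms by (intro mult_left_mono) auto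
  also have "\<dots> \<le> exp (- c) * (exp (- t) * v)"
    using exp_ge_add_one_self[of "- c"] assms(1) by (intro mult_right_mono) auto
  finally show ?thesis by (simp add: exp_add[symmetric] algebra_simps)
qed

lemma \<beta>_0: "\<beta> 0 x = 1 - exp (- x)"
  by (simp add: \<beta>_def exp_minus divide_simps)

section \<open>The loop invariant\<close>

locale gga_instance =
  fixes N :: "'a set" and f :: "nat \<Rightarrow> 'a set \<Rightarrow> real" and V :: "nat \<Rightarrow> real" and k m :: nat
    and enum :: "'a set \<Rightarrow> nat \<Rightarrow> 'a set list" and S :: "'a set"
  assumes fin: "finite N"
    and f: "\<forall>i\<in>{1,2}. mono_on (Pow N) (f i) \<and> submodular_on N (f i) \<and> f i {} = 0 \<and> V i \<ge> 0"
    and k: "0 < k" and m: "2 \<le> m" and enum: "enumerates N enum"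
    and S: "S \<subseteq> N" "card S = k" "\<forall>i\<in>{1,2}. f i S \<ge> V i"
begin

definition approx :: "'a set \<Rightarrow> bool" where
  "approx A \<longleftrightarrow> (\<forall>i\<in>{1,2}. f i A \<ge> (\<beta> 0 (real (card A) / real k) - 2 / real m) * V i)"

text \<open>A block of \<open>b\<close> elements adds only \<open>(b - 1) / k\<close> to the
  exponent, so \<open>j\<close> blocks fall short of \<open>card A / k\<close> by
  \<open>j / k\<close>.\<close>

definition residual :: "nat \<Rightarrow> 'a set \<Rightarrow> bool" where
  "residual j A \<longleftrightarrow> (\<forall>i\<in>{1,2}. V i - f i A \<le> exp (- ((real (card A) - real j) / real k)) * V i)"

text \<open>While the loop runs, \<open>cur s\<close> is a union of \<open>j\<close> blocks of full size \<open>m\<close>; only the last block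
  may be smaller.\<close>

definition inv :: "'a gga_state \<Rightarrow> bool" where
  "inv s \<longleftrightarrow> \<not> failed s \<and> cur s \<in> set (visited s) \<and> cur s \<subseteq> N \<and> card (cur s) \<le> k \<and>
    (card (cur s) < k \<longrightarrow> block s = m \<and> (\<exists>j. card (cur s) = m * j \<and> residual j (cur s))) \<and>
    (m \<le> k \<or> 3 \<le> k \<longrightarrow> (\<forall>A\<in>set (visited s). approx A)) \<and>
    queries s \<le> 6 * card (cur s) * card N ^ m"

lemma approx_empty: "approx {}"
  using f by (auto simp: approx_def \<beta>_0)

lemma inv_init: "inv (gga_init m)"
  using f k approx_empty by (auto simp: inv_def gga_init_def residual_def)

lemma residual_union:
  assumes "residual j A" "finite A" "finite X" "A \<inter> X = {}" "card A + card X \<le> k"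
    and "\<forall>i\<in>{1,2}. marginal (f i) X A \<ge> (real (card X) - 1) / real k * (V i - f i A)"
  shows "residual (Suc j) (A \<union> X)"
  unfolding residual_def
proof
  fix i :: nat assume i: "i \<in> {1,2}"
  have "V i - f i (A \<union> X) \<le>
      exp (- ((real (card A) - real j) / real k + (real (card X) - 1) / real k)) * V i"
  proof (rule residual_step)
    show "0 \<le> V i" using f i by blast
    show "V i - f i A \<le> exp (- ((real (card A) - real j) / real k)) * V i"
      using assms(1) i unfolding residual_def by blast
    show "(real (card X) - 1) / real k * (V i - f i A) \<le> f i (A \<union> X) - f i A"
      using assms(6) i unfolding marginal_def by blast
    show "(real (card X) - 1) / real k \<le> 1" using assms(5) k by (simp add: divide_simps)
  qed
  moreover have "(real (card A) - real j) / real k + (real (card X) - 1) / real k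
      = (real (card (A \<union> X)) - real (Suc j)) / real k"
    using assms(2-4) by (simp add: card_Un_disjoint add_divide_distrib[symmetric] algebra_simps)
  ultimately show "V i - f i (A \<union> X)
      \<le> exp (- ((real (card (A \<union> X)) - real (Suc j)) / real k)) * V i"
    by metis
qed

text \<open>The deficit \<open>j / k\<close> in the exponent costs at most \<open>j / k\<close>
  additively, and \<open>m * j \<le> k + m \<le> 2 * k\<close> bounds it by \<open>2 / m\<close>.
  The extra \<open>m\<close> leaves room for a truncated last block.\<close>

lemma approx_of_residual:
  assumes "residual j A" "j \<le> card A" "m * j \<le> k + m" "m \<le> k"
  shows "approx A"
  unfolding approx_def \<beta>_0
proof
  fix i :: nat assume i: "i \<in> {1,2}"
  have "real m * real j \<le> real k + real m" using assms(3) by (metis of_nat_add of_nat_le_iff of_nat_mult)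
  then have "real m * real j \<le> 2 * real k" using assms(4) by linarith
  then have jk: "real j / real k \<le> 2 / real m" using k m by (simp add: divide_simps mult.commute)
  have "exp (- ((real (card A) - real j) / real k))
      \<le> exp (- ((real (card A) - real j) / real k + real j / real k)) + real j / real k"
    using assms(2) by (intro exp_minus_shift_le) auto
  also have "(real (card A) - real j) / real k + real j / real k = real (card A) / real k"
    by (simp add: diff_divide_distrib)
  finally have "exp (- ((real (card A) - real j) / real k)) \<le> exp (- (real (card A) / real k)) + 2 / real m"
    using jk by linarith
  then have "exp (- ((real (card A) - real j) / real k)) * V i
      \<le> (exp (- (real (card A) / real k)) + 2 / real m) * V i"
    using f i by (intro mult_right_mono) auto
  moreover have "V i - f i A \<le> exp (- ((real (card A) - real j) / real k)) * V i"
    using assms(1) i unfolding residual_def by blast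
  ultimately show "(1 - exp (- (real (card A) / real k)) - 2 / real m) * V i \<le> f i A"
    by (simp add: algebra_simps)
qed

text \<open>If \<open>k < m\<close>, the whole output is found in one step, with loss \<open>1 / k \<le> 1 / 3 \<le> exp (- 1)\<close>.\<close>

lemma approx_single_block:
  assumes "card X = k" "3 \<le> k"
    and "\<forall>i\<in>{1,2}. f i X \<ge> (real k - 1) / real k * V i"
  shows "approx X"
  unfolding approx_def \<beta>_0
proof
  fix i :: nat assume i: "i \<in> {1,2}"
  have "1 / real k \<le> 1 / 3" using assms(2) by (intro divide_left_mono) auto
  also have "\<dots> \<le> exp (- 1)" using exp_le by (simp add: exp_minus divide_simps)
  finally have "1 - exp (- (real (card X) / real k)) - 2 / real m \<le> (real k - 1) / real k"
    using assms(1) k by (simp add: diff_divide_distrib) (smt (verit) of_nat_0_le_iff divide_nonneg_nonneg)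
  then have "(1 - exp (- (real (card X) / real k)) - 2 / real m) * V i \<le> (real k - 1) / real k * V i"
    using f i by (intro mult_right_mono) auto
  then show "(1 - exp (- (real (card X) / real k)) - 2 / real m) * V i \<le> f i X"
    using assms(3) i by force
qed

lemma inv_step:
  assumes inv: "inv s" and lt: "card (cur s) < k"
  shows "inv (gga_step N f V k enum s) \<and> card (cur s) < card (cur (gga_step N f V k enum s))"
proof -
  define A where "A = cur s"
  define b where "b = min m (k - card A)"
  obtain j where j: "card A = m * j" "residual j A" and bl: "block s = m"
    using inv lt unfolding inv_def A_def by blast
  have A: "A \<subseteq> N" "finite A" "card A < k"
    using inv lt fin finite_subset[of "cur s" N] unfolding inv_def A_def by auto
  have kN: "k \<le> card N" using S fin card_mono by blast
  have b: "1 \<le> b" "b \<le> m" "b \<le> k - card A" using A m by (auto simp: b_def)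
  have enum_b: "set (enum (N - A) b) = {X. X \<subseteq> N - A \<and> card X = b}"
    using enum unfolding enumerates_def by (meson Diff_subset)
  have "\<exists>X\<subseteq>N - A. card X = b \<and>
    (\<forall>i\<in>{1,2}. marginal (f i) X A \<ge> (real b - 1) / real k * (V i - f i A))"
    using f S A b fin by (intro admissible_set_exists) auto
  then obtain X0 where "X0 \<in> set (enum (N - A) b)"
    "\<forall>i\<in>{1,2}. marginal (f i) X0 A \<ge> (real b - 1) / real k * (V i - f i A)"
    using enum_b by auto
  from gga_find_Some[OF this]
  obtain X q where find: "gga_find f V k b A (enum (N - A) b) = (Some X, q)"
    and X: "X \<subseteq> N - A" "card X = b"
    and gain: "\<forall>i\<in>{1,2}. marginal (f i) X A \<ge> (real b - 1) / real k * (V i - f i A)"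
    using enum_b by (metis (mono_tags, lifting) mem_Collect_eq prod.collapse)
  define B where "B = A \<union> X"
  have step: "gga_step N f V k enum s =
      s\<lparr>block := b, cur := B, visited := visited s @ [B], queries := queries s + q\<rparr>"
    using find by (simp add: gga_step_def A_def[symmetric] bl b_def[symmetric] B_def)
  have finX: "finite X" using X fin finite_subset by blast
  have cB: "card B = card A + b"
    using X A finX unfolding B_def by (subst card_Un_disjoint) auto
  have res: "residual (Suc j) B"
    unfolding B_def using j A finX X b gain by (intro residual_union) auto
  have "b \<le> card (N - A)" using b(3) kN A fin by (simp add: card_Diff_subset)
  then have "length (enum (N - A) b) \<le> card N ^ m"
    using enum fin A b kN k by (intro length_enum_le) auto
  then have "q \<le> 6 * card N ^ m"
    using gga_find_queries[of f V k b A "enum (N - A) b"] find by simp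
  \<comment> \<open>The search is charged to the \<open>b \<ge> 1\<close> elements it adds, matching
    the bound in the invariant.\<close>
  also have "\<dots> \<le> 6 * b * card N ^ m" using b by simp
  finally have "queries s + q \<le> 6 * card B * card N ^ m"
    using inv unfolding inv_def cB A_def by (simp add: algebra_simps)
  moreover have "approx B" if "m \<le> k \<or> 3 \<le> k"
  proof (cases "m \<le> k")
    case True
    have "j \<le> m * j" using m by simp
    then have "Suc j \<le> card B" using j b unfolding cB by linarith
    moreover have "m * Suc j \<le> k + m" using j A by simp
    ultimately show ?thesis using approx_of_residual res True by blast
  next
    case False
    \<comment> \<open>Here \<open>m * j = card A < k < m\<close>, so this is the first block and it
      is the whole output.\<close>
    then have "j = 0" using j A by (cases j) auto
    then have A0: "A = {}" using j A by simp
    then have "b = k" using False by (simp add: b_def)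
    then show ?thesis
      using approx_single_block[of X] that False X gain f A0
      by (auto simp: B_def marginal_def)
  qed
  moreover have "b = m \<and> (\<exists>j. card B = m * j \<and> residual j B)" if "card B < k"
  proof -
    \<comment> \<open>A block smaller than \<open>m\<close> fills \<open>A\<close> up to size
      \<open>k\<close> exactly, so it can only be the last one.\<close>
    have "b = m" using that unfolding cB by (auto simp: b_def min_def split: if_splits)
    then show ?thesis using res j(1) cB by (intro conjI exI[of _ "Suc j"]) auto
  qed
  moreover have "B \<subseteq> N" "card B \<le> k" using A X b by (auto simp: B_def[symmetric] cB) (auto simp: B_def)
  ultimately have "inv (gga_step N f V k enum s)"
    using inv unfolding step inv_def by auto
  then show ?thesis using cB b by (simp add: step A_def)
qed

section \<open>Termination and the final bounds\<close>

lemma gga_terminates: "\<exists>s. gga N f V k enum m = Some s \<and> inv s \<and> card (cur s) = k"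
proof -
  let ?b = "\<lambda>s. card (cur s) < k \<and> \<not> failed s" and ?c = "gga_step N f V k enum"
  have "\<exists>s. while_option ?b ?c (gga_init m) = Some s"
  proof (rule measure_while_option_Some[where P = inv and f = "\<lambda>s. k - card (cur s)"])
    show "inv (?c s) \<and> k - card (cur (?c s)) < k - card (cur s)" if "inv s" "?b s" for s
      using inv_step[of s] that by auto
  qed (rule inv_init)
  then obtain s where s: "while_option ?b ?c (gga_init m) = Some s" by blast
  have "inv s"
    using while_option_rule[OF _ s, of inv] inv_step inv_init by blast
  \<comment> \<open>The invariant rules out \<open>failed s\<close>, so the loop can only have
    stopped because size \<open>k\<close> was reached.\<close>
  moreover have "\<not> ?b s" using while_option_stop[OF s] .
  ultimately show ?thesis using s unfolding gga_def inv_def by auto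
qed

end

text \<open>The guard \<open>m \<le> k \<or> 3 \<le> k\<close> excludes \<open>k = 1\<close> and
  \<open>k = 2\<close> with larger \<open>m\<close>. There the single search ensures only the
  fraction \<open>(k - 1) / k\<close> of \<open>V i\<close>, that is 0 or 1/2, and for large
  \<open>m\<close> an error of order \<open>1 / m\<close> does not cover the gap to
  \<open>1 - exp (- 1)\<close>.\<close>

theorem theorem10:
  "\<exists>(C::real) (D::real) (\<delta>::nat \<Rightarrow> real).
    (\<forall>m\<ge>2. \<delta> m \<le> C / real m) \<and>
    (\<forall>(N::'a set) (f::nat \<Rightarrow> 'a set \<Rightarrow> real) (V::nat \<Rightarrow> real) (k::nat) (m::nat) enum.
      finite N \<longrightarrow>
      (\<forall>i\<in>{1,2}. mono_on (Pow N) (f i) \<and> submodular_on N (f i) \<and> f i {} = 0 \<and> V i \<ge> 0) \<longrightarrow>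
      k > 0 \<longrightarrow> m \<ge> 2 \<longrightarrow> enumerates N enum \<longrightarrow>
      (\<exists>S\<subseteq>N. card S = k \<and> (\<forall>i\<in>{1,2}. f i S \<ge> V i)) \<longrightarrow>
      (\<exists>s. gga N f V k enum m = Some s \<and> \<not> failed s \<and>
        cur s \<in> set (visited s) \<and> cur s \<subseteq> N \<and> card (cur s) = k \<and>
        (m \<le> k \<or> 3 \<le> k \<longrightarrow>
          (\<forall>A\<in>set (visited s). \<forall>l. card A = l \<longrightarrow>
            (\<forall>i\<in>{1,2}. f i A \<ge> (\<beta> 0 (real l / real k) - \<delta> m) * V i))) \<and>
        real (queries s) \<le> D * real (card N) ^ (m + 1)))"
\<comment> \<open>The 2 stems from \<open>j / k \<le> 2 / m\<close>, the 6 from the queries per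
  candidate.\<close>
proof (rule exI[of _ 2], rule exI[of _ 6], rule exI[of _ "\<lambda>m. 2 / real m"], intro conjI allI impI)
  fix N :: "'a set" and f :: "nat \<Rightarrow> 'a set \<Rightarrow> real" and V :: "nat \<Rightarrow> real" and k m :: nat and enum
  assume fin: "finite N"
    and f: "\<forall>i\<in>{1,2}. mono_on (Pow N) (f i) \<and> submodular_on N (f i) \<and> f i {} = 0 \<and> V i \<ge> 0"
    and km: "k > 0" "m \<ge> 2" and enum: "enumerates N enum"
    and "\<exists>S\<subseteq>N. card S = k \<and> (\<forall>i\<in>{1,2}. f i S \<ge> V i)"
  then obtain S where S: "S \<subseteq> N" "card S = k" "\<forall>i\<in>{1,2}. f i S \<ge> V i" by blast
  interpret gga_instance N f V k m enum S
    by unfold_locales (fact fin f km enum S)+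
  obtain s where s: "gga N f V k enum m = Some s" "inv s" "card (cur s) = k"
    using gga_terminates by blast
  have "k \<le> card N" using S fin card_mono by blast
  \<comment> \<open>The factor \<open>k \<le> card N\<close> is absorbed into one more power of
    \<open>card N\<close>.\<close>
  then have "6 * k * card N ^ m \<le> 6 * card N ^ (m + 1)" by simp
  then have "queries s \<le> 6 * card N ^ (m + 1)"
    using s unfolding inv_def by (metis order_trans)
  then have "real (queries s) \<le> 6 * real (card N) ^ (m + 1)"
    by (metis of_nat_le_iff of_nat_mult of_nat_numeral of_nat_power)
  then show "\<exists>s. gga N f V k enum m = Some s \<and> \<not> failed s \<and>
        cur s \<in> set (visited s) \<and> cur s \<subseteq> N \<and> card (cur s) = k \<and>
        (m \<le> k \<or> 3 \<le> k \<longrightarrow>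
          (\<forall>A\<in>set (visited s). \<forall>l. card A = l \<longrightarrow>
            (\<forall>i\<in>{1,2}. f i A \<ge> (\<beta> 0 (real l / real k) - 2 / real m) * V i))) \<and>
        real (queries s) \<le> 6 * real (card N) ^ (m + 1)"
    using s unfolding inv_def approx_def by blast
qed simp

end
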